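(* Let $n\ge1$. A functional $Z\colon\mathrm{Conv}_{\rm sc}(\mathbb{R}^n)\to\mathbb{R}$ is a continuous and epi-translation invariant valuation that is epi-homogeneous of degree $0$ if and only if $Z$ is constant.
   Context: $\mathrm{Conv}(\mathbb{R}^n)$ is the set of convex, lower semicontinuous functions $u\colon\mathbb{R}^n\to\mathbb{R}\cup\{+\infty\}$ with $u\not\equiv+\infty$. $\mathrm{Conv}_{\rm sc}(\mathbb{R}^n)$ is the subset of super-coercive functions, i.e. those with $\lim_{|x|\to+\infty}u(x)/|x|=+\infty$. Topology: continuity is with respect to epi-convergence. A sequence $u_k$ epi-converges to $u$ if for every $x\in\mathbb{R}^n$: (i) $u(x)\le\liminf_{k\to\infty}u_k(x_k)$ for every sequence $x_k\to x$, and (ii) there is a sequence $x_k\to x$ with $u(x)=\lim_{k\to\infty}u_k(x_k)$. A functional $Z\colon X\to\mathbb{R}$ on a set $X$ of functions is a valuation if $Z(u\vee v)+Z(u\wedge v)=Z(u)+Z(v)$ for all $u,v\in X$ with $u\vee v\in X$ and $u\wedge v\in X$, where $\vee$ and $\wedge$ denote pointwise maximum and minimum. $Z$ is epi-translation invariant if $Z(u\circ\tau^{-1})=Z(u)$ for all $u$ and all translations $\tau$ of $\mathbb{R}^n$, and $Z(u+\alpha)=Z(u)$ for all $u$ and all constants $\alpha\in\mathbb{R}$. For $\lambda>0$, epi-multiplication is $(\lambda\cdot_{\rm epi}u)(x)=\lambda\,u(x/\lambda)$. $Z$ is epi-homogeneous of degree $\alpha\in\mathbb{R}$ if $Z(\lambda\cdot_{\rm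 epi}u)=\lambda^\alpha Z(u)$ for all $u$ and all $\lambda>0$. *)

theory Defs
  imports "HOL-Analysis.Analysis"
begin

(* Functions into the reals extended by plus infinity are ereal-valued functions that omit
   -\<infinity>; see Conv below. *)

definition ereal_convex :: "('a::real_vector \<Rightarrow> ereal) \<Rightarrow> bool" where
  "ereal_convex u \<longleftrightarrow>
     (\<forall>x y t. 0 < t \<and> t < 1 \<longrightarrow>
        u ((1 - t) *\<^sub>R x + t *\<^sub>R y) \<le> ereal (1 - t) * u x + ereal t * u y)"

definition lower_semicontinuous :: "('a::topological_space \<Rightarrow> ereal) \<Rightarrow> bool" where
  "lower_semicontinuous u \<longleftrightarrow> (\<forall>x. u x \<le> Liminf (at x) u)"

definition Conv :: "('a::real_normed_vector \<Rightarrow> ereal) set" where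
  "Conv = {u. (\<forall>x. u x \<noteq> -\<infinity>) \<and> (\<exists>x. u x \<noteq> \<infinity>) \<and> ereal_convex u \<and> lower_semicontinuous u}"

definition super_coercive :: "('a::real_normed_vector \<Rightarrow> ereal) \<Rightarrow> bool" where
  "super_coercive u \<longleftrightarrow> ((\<lambda>x. u x / ereal (norm x)) \<longlongrightarrow> \<infinity>) at_infinity"

definition Conv_sc :: "('a::real_normed_vector \<Rightarrow> ereal) set" where
  "Conv_sc = {u \<in> Conv. super_coercive u}"

definition epi_converges ::
  "(nat \<Rightarrow> 'a::topological_space \<Rightarrow> ereal) \<Rightarrow> ('a \<Rightarrow> ereal) \<Rightarrow> bool" where
  "epi_converges us u \<longleftrightarrow>
     (\<forall>x. (\<forall>xs. xs \<longlonglongrightarrow> x \<longrightarrow> u x \<le> liminf (\<lambda>k. us k (xs k))) \<and>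
          (\<exists>xs. xs \<longlonglongrightarrow> x \<and> (\<lambda>k. us k (xs k)) \<longlonglongrightarrow> u x))"

definition epi_continuous_on ::
  "('a::topological_space \<Rightarrow> ereal) set \<Rightarrow> (('a \<Rightarrow> ereal) \<Rightarrow> real) \<Rightarrow> bool" where
  "epi_continuous_on X Z \<longleftrightarrow>
     (\<forall>us u. (\<forall>k. us k \<in> X) \<and> u \<in> X \<and> epi_converges us u \<longrightarrow> (\<lambda>k. Z (us k)) \<longlonglongrightarrow> Z u)"

definition valuation_on :: "('a \<Rightarrow> ereal) set \<Rightarrow> (('a \<Rightarrow> ereal) \<Rightarrow> real) \<Rightarrow> bool" where
  "valuation_on X Z \<longleftrightarrow>
     (\<forall>u\<in>X. \<forall>v\<in>X. (\<lambda>x. max (u x) (v x)) \<in> X \<and> (\<lambda>x. min (u x) (v x)) \<in> X \<longrightarrow>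
        Z (\<lambda>x. max (u x) (v x)) + Z (\<lambda>x. min (u x) (v x)) = Z u + Z v)"

definition epi_translation_invariant_on ::
  "('a::real_vector \<Rightarrow> ereal) set \<Rightarrow> (('a \<Rightarrow> ereal) \<Rightarrow> real) \<Rightarrow> bool" where
  "epi_translation_invariant_on X Z \<longleftrightarrow>
     (\<forall>u\<in>X. (\<forall>a. Z (\<lambda>x. u (x - a)) = Z u) \<and> (\<forall>c::real. Z (\<lambda>x. u x + ereal c) = Z u))"

definition epi_mult :: "real \<Rightarrow> ('a::real_vector \<Rightarrow> ereal) \<Rightarrow> 'a \<Rightarrow> ereal" where
  "epi_mult l u = (\<lambda>x. ereal l * u (x /\<^sub>R l))"

definition epi_homogeneous_on ::
  "real \<Rightarrow> ('a::real_vector \<Rightarrow> ereal) set \<Rightarrow> (('a \<Rightarrow> ereal) \<Rightarrow> real) \<Rightarrow> bool" where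
  "epi_homogeneous_on \<alpha> X Z \<longleftrightarrow> (\<forall>u\<in>X. \<forall>l>0. Z (epi_mult l u) = l powr \<alpha> * Z u)"

end

(* Translate so that 0 lies in the domain of u. By super-coercivity, the epi-multiples l u(x/l)
   then epi-converge, as l tends to 0, to the indicator function of {0}. Homogeneity of degree 0 and continuity then
   force Z u to be the value of Z at that indicator. *)

theory Submission
  imports Defs
begin

text \<open>The definition uses punctured neighbourhoods. They may be replaced by full ones, because
  at \<open>x\<close> itself the condition is the premise \<open>y < u x\<close>.\<close>

lemma lower_semicontinuous_iff:
  "lower_semicontinuous u \<longleftrightarrow> (\<forall>x y. y < u x \<longrightarrow> (\<forall>\<^sub>F z in nhds x. y < u z))"
  unfolding lower_semicontinuous_def le_Liminf_iff eventually_nhds_conv_at by blast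

text \<open>Replaces the quotient by lower bounds of every slope. To exceed slope \<open>r\<close>,
  take the bound of slope \<open>r + 1\<close>: the surplus \<open>norm x\<close> absorbs the
  constant \<open>m\<close> far out.\<close>

lemma super_coerciveI:
  assumes "\<And>K. \<exists>m. \<forall>x. ereal (K * norm x - m) \<le> u x"
  shows "super_coercive u"
  unfolding super_coercive_def tendsto_PInfty
proof
  fix r
  obtain m where m: "\<And>x. ereal ((r + 1) * norm x - m) \<le> u x"
    using assms by blast
  have "ereal r < u x / ereal (norm x)" if "max 1 (m + 1) \<le> norm x" for x
  proof -
    have "r * norm x < (r + 1) * norm x - m"
      using that by (simp add: algebra_simps)
    then have "ereal (r * norm x) < u x"
      using m[of x] by (meson ereal_less_eq(3) less_ereal.simps(1) less_le_trans)
    moreover have "norm x > 0"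
      using that by linarith
    ultimately show ?thesis
      by (cases "u x") (auto simp: pos_less_divide_eq)
  qed
  then show "\<forall>\<^sub>F x in at_infinity. ereal r < u x / ereal (norm x)"
    unfolding eventually_at_infinity by blast
qed

text \<open>Far out the bound is super-coercivity. On a ball it follows from lower semicontinuity at
  one domain point \<open>x0\<close>: by convexity, a very low value anywhere in the ball would pull
  \<open>u\<close> below \<open>c - 1\<close> near \<open>x0\<close>.\<close>

lemma Conv_sc_minorant:
  assumes "u \<in> Conv_sc"
  shows "\<exists>m. \<forall>x. ereal (K * norm x - m) \<le> u x"
proof -
  have conv: "ereal_convex u" and lsc: "lower_semicontinuous u" and sc: "super_coercive u"
    and ninf: "\<And>x. u x \<noteq> -\<infinity>" and "\<exists>x. u x \<noteq> \<infinity>"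
    using assms by (auto simp: Conv_sc_def Conv_def)
  then obtain x0 where "u x0 \<noteq> \<infinity>" by blast
  then obtain c where c: "u x0 = ereal c"
    using ninf[of x0] by (cases "u x0") auto
  have "\<forall>\<^sub>F z in nhds x0. ereal (c - 1) < u z"
    using lsc unfolding lower_semicontinuous_iff by (simp add: c)
  then obtain d where d: "d > 0" "\<And>z. dist z x0 < d \<Longrightarrow> ereal (c - 1) < u z"
    unfolding eventually_nhds_metric by blast
  have "\<forall>\<^sub>F x in at_infinity. ereal K < u x / ereal (norm x)"
    using sc unfolding super_coercive_def tendsto_PInfty by blast
  then obtain b where b: "\<And>x. b \<le> norm x \<Longrightarrow> ereal K < u x / ereal (norm x)"
    unfolding eventually_at_infinity by blast
  define R where "R = max b 1"
  have far: "ereal (K * norm x) \<le> u x" if "R \<le> norm x" for x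
  proof -
    have "ereal K < u x / ereal (norm x)" and "norm x > 0"
      using that b[of x] by (auto simp: R_def)
    then show ?thesis
      by (cases "u x") (auto simp: pos_less_divide_eq)
  qed
  \<comment> \<open>\<open>R + norm x0\<close> bounds the distance from \<open>x0\<close> to any
    point of the ball of radius \<open>R\<close>, so moving from \<open>x0\<close> a fraction
    \<open>t\<close> of the way stays within \<open>d\<close> of \<open>x0\<close>. The bound 1/2
    keeps \<open>t < 1\<close>.\<close>
  define t where "t = min (1/2) (d / (2 * (R + norm x0)))"
  have R: "R \<ge> 1" by (simp add: R_def)
  then have pos: "R + norm x0 > 0"
    by (smt (verit) norm_ge_zero)
  have t: "0 < t" "t < 1"
    using d(1) pos by (auto simp: t_def)
  have td: "t * (R + norm x0) < d"
  proof -
    have "t * (R + norm x0) \<le> d / (2 * (R + norm x0)) * (R + norm x0)"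
      using pos by (intro mult_right_mono) (auto simp: t_def)
    also have "\<dots> = d / 2"
      using pos by (auto simp: field_simps)
    finally show ?thesis using d(1) by simp
  qed
  have near: "ereal (c - 1 / t) \<le> u x" if "norm x < R" for x
  proof -
    have "(1 - t) *\<^sub>R x0 + t *\<^sub>R x - x0 = t *\<^sub>R (x - x0)"
      by (simp add: algebra_simps)
    then have "dist ((1 - t) *\<^sub>R x0 + t *\<^sub>R x) x0 = t * norm (x - x0)"
      using t by (simp add: dist_norm)
    also have "\<dots> \<le> t * (R + norm x0)"
      using t that norm_triangle_ineq4[of x x0] by (intro mult_left_mono) auto
    finally have "ereal (c - 1) < u ((1 - t) *\<^sub>R x0 + t *\<^sub>R x)"
      using d(2) td by simp
    also have "\<dots> \<le> ereal (1 - t) * u x0 + ereal t * u x"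
      using conv t unfolding ereal_convex_def by blast
    finally have *: "ereal (c - 1) < ereal (1 - t) * ereal c + ereal t * u x"
      by (simp add: c)
    show ?thesis
    proof (cases "u x")
      case (real a)
      then have "t * c - 1 \<le> t * a"
        using * by (simp add: algebra_simps)
      then have "c - 1 / t \<le> a"
        using t by (simp add: field_simps)
      then show ?thesis by (simp add: real)
    qed (use ninf in auto)
  qed
  \<comment> \<open>The first summand absorbs \<open>K * norm x\<close> inside the ball, the other
    two give \<open>- \<bar>c\<bar> - 1 / t \<le> c - 1 / t\<close>. Outside the ball only
    \<open>m \<ge> 0\<close> matters.\<close>
  define m where "m = \<bar>K\<bar> * R + \<bar>c\<bar> + 1 / t"
  have m: "m \<ge> 0"
    using R t by (simp add: m_def)
  have "ereal (K * norm x - m) \<le> u x" for x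
  proof (cases "R \<le> norm x")
    case True
    have "ereal (K * norm x - m) \<le> ereal (K * norm x)" using m by simp
    then show ?thesis using far[OF True] by (rule order_trans)
  next
    case False
    have "K * norm x \<le> \<bar>K\<bar> * R"
      using False R by (intro mult_mono) auto
    then have "ereal (K * norm x - m) \<le> ereal (c - 1 / t)"
      by (simp add: m_def)
    then show ?thesis using near[of x] False by (meson not_le order_trans)
  qed
  then show ?thesis by blast
qed

text \<open>A common generalisation of translation, addition of a constant and epi-multiplication,
  so that the closure properties are checked only once.\<close>

lemma Conv_sc_affine:
  assumes u: "u \<in> Conv_sc" and l: "l > 0" and r: "r > 0"
  shows "(\<lambda>x. ereal l * u (r *\<^sub>R (x - a)) + ereal c) \<in> Conv_sc" (is "?v \<in> _")
proof -
  have conv: "ereal_convex u" and lsc: "lower_semicontinuous u"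
    and ninf: "\<And>x. u x \<noteq> -\<infinity>" and dom: "\<exists>x. u x \<noteq> \<infinity>"
    using u by (auto simp: Conv_sc_def Conv_def)
  have ninf': "?v x \<noteq> -\<infinity>" for x
    using ninf[of "r *\<^sub>R (x - a)"] l by (cases "u (r *\<^sub>R (x - a))") auto
  obtain x0 where x0: "u x0 \<noteq> \<infinity>" using dom by blast
  have "?v (x0 /\<^sub>R r + a) \<noteq> \<infinity>"
    using x0 ninf[of x0] l r by (cases "u x0") auto
  then have dom': "\<exists>x. ?v x \<noteq> \<infinity>" by blast
  have conv': "ereal_convex ?v"
    unfolding ereal_convex_def
  proof (intro allI impI)
    fix x y :: 'a and t :: real
    assume t: "0 < t \<and> t < 1"
    let ?A = "u (r *\<^sub>R (x - a))" and ?B = "u (r *\<^sub>R (y - a))"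
    have "r *\<^sub>R ((1 - t) *\<^sub>R x + t *\<^sub>R y - a) = (1 - t) *\<^sub>R (r *\<^sub>R (x - a)) + t *\<^sub>R (r *\<^sub>R (y - a))"
      by (simp add: algebra_simps)
    then have "u (r *\<^sub>R ((1 - t) *\<^sub>R x + t *\<^sub>R y - a)) \<le> ereal (1 - t) * ?A + ereal t * ?B"
      using conv t unfolding ereal_convex_def by metis
    then have "?v ((1 - t) *\<^sub>R x + t *\<^sub>R y) \<le> ereal l * (ereal (1 - t) * ?A + ereal t * ?B) + ereal c"
      using l by (intro add_right_mono ereal_mult_left_mono) auto
    also have "\<dots> = ereal (1 - t) * ?v x + ereal t * ?v y"
      using ninf[of "r *\<^sub>R (x - a)"] ninf[of "r *\<^sub>R (y - a)"] l t
      by (cases ?A; cases ?B) (auto simp: algebra_simps)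
    finally show "?v ((1 - t) *\<^sub>R x + t *\<^sub>R y) \<le> ereal (1 - t) * ?v x + ereal t * ?v y" .
  qed
  \<comment> \<open>Inverts the increasing map \<open>w\<close> to \<open>l * w + c\<close> on the
    extended reals. Lower semicontinuity of \<open>?v\<close> thereby reduces to that of
    \<open>u\<close> composed with a continuous map.\<close>
  have solve: "y < ereal l * w + ereal c \<longleftrightarrow> (y - ereal c) / ereal l < w" for y w
    using l by (cases y; cases w) (auto simp: field_simps)
  have lsc': "lower_semicontinuous ?v"
    unfolding lower_semicontinuous_iff solve
  proof (intro allI impI)
    fix x y
    assume "(y - ereal c) / ereal l < u (r *\<^sub>R (x - a))"
    then have "\<forall>\<^sub>F z in nhds (r *\<^sub>R (x - a)). (y - ereal c) / ereal l < u z"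
      using lsc unfolding lower_semicontinuous_iff by blast
    moreover have "((\<lambda>z. r *\<^sub>R (z - a)) \<longlongrightarrow> r *\<^sub>R (x - a)) (nhds x)"
      by (intro tendsto_intros filterlim_ident)
    ultimately show "\<forall>\<^sub>F z in nhds x. (y - ereal c) / ereal l < u (r *\<^sub>R (z - a))"
      by (rule eventually_compose_filterlim)
  qed
  have "super_coercive ?v"
  proof (rule super_coerciveI)
    fix K
    \<comment> \<open>Scaling by \<open>r\<close> inside and \<open>l\<close> outside turns this
      slope into \<open>\<bar>K\<bar>\<close>. The absolute value lets the triangle inequality for
      the shift by \<open>a\<close> be multiplied by the slope.\<close>
    obtain m where m: "\<And>x. ereal (\<bar>K\<bar> / (l * r) * norm x - m) \<le> u x"
      using Conv_sc_minorant[OF u] by blast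
    have "ereal (K * norm x - (\<bar>K\<bar> * norm a + l * m - c)) \<le> ?v x" for x
    proof -
      have "K * norm x \<le> \<bar>K\<bar> * (norm (x - a) + norm a)"
        using norm_triangle_sub[of x a] by (intro mult_mono) (auto simp: add.commute)
      then have "K * norm x - (\<bar>K\<bar> * norm a + l * m - c)
          \<le> l * (\<bar>K\<bar> / (l * r) * norm (r *\<^sub>R (x - a)) - m) + c"
        using l r by (simp add: distrib_left right_diff_distrib)
      also have "ereal \<dots> \<le> ?v x"
        using add_right_mono[OF ereal_mult_left_mono[OF m, of "ereal l" "r *\<^sub>R (x - a)"], of "ereal c"] l
        by simp
      finally show ?thesis by simp
    qed
    then show "\<exists>m. \<forall>x. ereal (K * norm x - m) \<le> ?v x" by blast
  qed
  then show ?thesis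
    using ninf' dom' conv' lsc' by (auto simp: Conv_sc_def Conv_def)
qed

lemma Conv_sc_translate: "u \<in> Conv_sc \<Longrightarrow> (\<lambda>x. u (x - a)) \<in> Conv_sc"
  using Conv_sc_affine[of u 1 1 a 0] by (simp flip: one_ereal_def zero_ereal_def)

lemma Conv_sc_add_const: "u \<in> Conv_sc \<Longrightarrow> (\<lambda>x. u x + ereal c) \<in> Conv_sc"
  using Conv_sc_affine[of u 1 1 0 c] by (simp flip: one_ereal_def)

lemma Conv_sc_epi_mult: "u \<in> Conv_sc \<Longrightarrow> l > 0 \<Longrightarrow> epi_mult l u \<in> Conv_sc"
  using Conv_sc_affine[of u l "inverse l" 0 0] by (simp add: epi_mult_def flip: zero_ereal_def)

text \<open>The indicator in the sense of convex analysis, not the 0-1 valued one. It is fixed by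
  every epi-multiplication with a positive factor.\<close>

definition ind_zero :: "'a::real_normed_vector \<Rightarrow> ereal" where
  "ind_zero x = (if x = 0 then 0 else \<infinity>)"

text \<open>\<open>epi_continuous_on\<close> speaks only of limits inside the set, so the limit
  function must be known to belong to it.\<close>

lemma ind_zero_in_Conv_sc: "ind_zero \<in> Conv_sc"
proof -
  have "ereal_convex (ind_zero :: 'a \<Rightarrow> ereal)"
    unfolding ereal_convex_def by (auto simp: ind_zero_def)
  moreover have "lower_semicontinuous (ind_zero :: 'a \<Rightarrow> ereal)"
    unfolding lower_semicontinuous_iff
  proof (intro allI impI)
    fix x :: 'a and y
    assume y: "y < ind_zero x"
    show "\<forall>\<^sub>F z in nhds x. y < ind_zero z"
    proof (cases "x = 0")
      case True
      with y have "y < ind_zero z" for z :: 'a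
        by (auto simp: ind_zero_def)
      then show ?thesis by simp
    next
      case False
      then have "\<forall>\<^sub>F z in nhds x. z \<noteq> 0"
        by (rule t1_space_nhds)
      then show ?thesis
        by eventually_elim (use y False in \<open>simp add: ind_zero_def\<close>)
    qed
  qed
  moreover have "super_coercive (ind_zero :: 'a \<Rightarrow> ereal)"
  proof (rule super_coerciveI)
    fix K
    have "\<forall>x. ereal (K * norm x - 0) \<le> ind_zero (x :: 'a)"
      by (auto simp: ind_zero_def)
    then show "\<exists>m. \<forall>x. ereal (K * norm x - m) \<le> ind_zero (x :: 'a)" by blast
  qed
  ultimately show ?thesis
    by (auto simp: Conv_sc_def Conv_def ind_zero_def intro: exI[of _ 0])
qed

text \<open>Epi-multiplication by \<open>l\<close> turns a minorant \<open>K * norm x - m\<close>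
  into \<open>K * norm x - l * m\<close>: the slope survives and the constant vanishes as
  \<open>l\<close> tends to 0. Since \<open>K\<close> is arbitrary, the limit is infinite off the
  origin.\<close>

lemma epi_mult_epi_converges_ind_zero:
  assumes u: "u \<in> Conv_sc" and u0: "u 0 \<noteq> \<infinity>"
    and l: "\<And>k. l k > 0" "l \<longlonglongrightarrow> 0"
  shows "epi_converges (\<lambda>k. epi_mult (l k) u) ind_zero"
proof -
  have lower: "ind_zero x \<le> liminf (\<lambda>k. epi_mult (l k) u (xs k))" if xs: "xs \<longlonglongrightarrow> x" for x xs
  proof -
    have *: "ereal (K * norm x) \<le> liminf (\<lambda>k. epi_mult (l k) u (xs k))" for K
    proof -
      obtain m where m: "\<And>x. ereal (K * norm x - m) \<le> u x"
        using Conv_sc_minorant[OF u] by blast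
      have "ereal (K * norm (xs k) - l k * m) \<le> epi_mult (l k) u (xs k)" for k
      proof -
        have "ereal (l k) * ereal (K * norm (xs k /\<^sub>R l k) - m) \<le> epi_mult (l k) u (xs k)"
          unfolding epi_mult_def using l(1)[of k] by (intro ereal_mult_left_mono m) auto
        moreover have "l k * (K * norm (xs k /\<^sub>R l k) - m) = K * norm (xs k) - l k * m"
          using l(1)[of k] by (simp add: field_simps)
        ultimately show ?thesis by simp
      qed
      then have "liminf (\<lambda>k. ereal (K * norm (xs k) - l k * m)) \<le> liminf (\<lambda>k. epi_mult (l k) u (xs k))"
        by (intro Liminf_mono) simp
      moreover have "(\<lambda>k. K * norm (xs k) - l k * m) \<longlonglongrightarrow> K * norm x - 0 * m"
        by (intro tendsto_intros xs l(2))
      then have "liminf (\<lambda>k. ereal (K * norm (xs k) - l k * m)) = ereal (K * norm x)"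
        by (intro lim_imp_Liminf) simp_all
      ultimately show ?thesis by simp
    qed
    show ?thesis
    proof (cases "x = 0")
      case True
      then show ?thesis using *[of 0] by (simp add: ind_zero_def zero_ereal_def)
    next
      case False
      then have "ereal B \<le> liminf (\<lambda>k. epi_mult (l k) u (xs k))" for B
        using *[of "B / norm x"] by simp
      then have "liminf (\<lambda>k. epi_mult (l k) u (xs k)) = \<infinity>"
        by (rule ereal_top)
      then show ?thesis by simp
    qed
  qed
  \<comment> \<open>Constant sequences serve as recovery sequences. At the origin the values are
    \<open>l k * u 0\<close> with \<open>u 0\<close> finite; elsewhere the liminf inequality already
    forces the limit to be infinite.\<close>
  have "(\<lambda>k. epi_mult (l k) u x) \<longlonglongrightarrow> ind_zero x" for x
  proof (cases "x = 0")
    case True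
    have "u 0 \<noteq> -\<infinity>"
      using u by (auto simp: Conv_sc_def Conv_def)
    then obtain c where "u 0 = ereal c"
      using u0 by (cases "u 0") auto
    moreover have "(\<lambda>k. l k * c) \<longlonglongrightarrow> 0 * c"
      by (intro tendsto_intros l(2))
    ultimately show ?thesis
      using True by (simp add: epi_mult_def ind_zero_def zero_ereal_def)
  next
    case False
    have "ind_zero x \<le> liminf (\<lambda>k. epi_mult (l k) u x)"
      by (rule lower) simp
    then have "liminf (\<lambda>k. epi_mult (l k) u x) = \<infinity>"
      using False by (simp add: ind_zero_def)
    then show ?thesis
      using False Liminf_le_Limsup[of sequentially "\<lambda>k. epi_mult (l k) u x"]
      by (intro Liminf_eq_Limsup) (auto simp: ind_zero_def)
  qed
  then show ?thesis
    unfolding epi_converges_def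
    by (intro allI conjI impI lower exI[of _ "\<lambda>_. x" for x]) auto
qed

theorem theorem25:
  fixes Z :: "(real ^ 'n \<Rightarrow> ereal) \<Rightarrow> real"
  shows "(epi_continuous_on Conv_sc Z \<and> epi_translation_invariant_on Conv_sc Z \<and>
          valuation_on Conv_sc Z \<and> epi_homogeneous_on 0 Conv_sc Z)
         \<longleftrightarrow> Z constant_on Conv_sc"
proof
  assume Z: "epi_continuous_on Conv_sc Z \<and> epi_translation_invariant_on Conv_sc Z \<and>
          valuation_on Conv_sc Z \<and> epi_homogeneous_on 0 Conv_sc Z"
  have "Z u = Z ind_zero" if u: "u \<in> Conv_sc" for u
  proof -
    obtain x0 where "u x0 \<noteq> \<infinity>"
      using u by (auto simp: Conv_sc_def Conv_def)
    \<comment> \<open>Then \<open>v 0 = u x0\<close> is finite. The double negation matches the form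
      \<open>u (x - a)\<close> used for translation invariance.\<close>
    define v where "v = (\<lambda>x. u (x - (- x0)))"
    have v: "v \<in> Conv_sc"
      unfolding v_def by (rule Conv_sc_translate[OF u])
    have "v 0 \<noteq> \<infinity>"
      using \<open>u x0 \<noteq> \<infinity>\<close> by (simp add: v_def)
    \<comment> \<open>A positive null sequence; \<open>Suc\<close> is needed because
      \<open>inverse 0 = 0\<close> would not be positive.\<close>
    define l where "l k = inverse (real (Suc k))" for k
    have l: "l k > 0" for k by (simp add: l_def)
    have "l \<longlonglongrightarrow> 0"
      unfolding l_def by (rule LIMSEQ_inverse_real_of_nat)
    with v \<open>v 0 \<noteq> \<infinity>\<close> l have "epi_converges (\<lambda>k. epi_mult (l k) v) ind_zero"
      by (rule epi_mult_epi_converges_ind_zero)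
    then have "(\<lambda>k. Z (epi_mult (l k) v)) \<longlonglongrightarrow> Z ind_zero"
      using Z Conv_sc_epi_mult[OF v l] by (simp add: epi_continuous_on_def ind_zero_in_Conv_sc)
    \<comment> \<open>Positivity of \<open>l k\<close> gives \<open>l k powr 0 = 1\<close>. The
      convergent sequence is thus constant, and its limit is \<open>Z v\<close>.\<close>
    moreover have "Z (epi_mult (l k) v) = Z v" for k
      using Z v l[of k] by (simp add: epi_homogeneous_on_def)
    ultimately have "Z v = Z ind_zero"
      by (simp add: LIMSEQ_const_iff)
    moreover have "Z v = Z u"
      using Z u unfolding epi_translation_invariant_on_def v_def by blast
    ultimately show ?thesis by simp
  qed
  then show "Z constant_on Conv_sc"
    unfolding constant_on_def by blast
next
  assume "Z constant_on Conv_sc"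
  then obtain c where c: "\<And>u. u \<in> Conv_sc \<Longrightarrow> Z u = c"
    unfolding constant_on_def by blast
  \<comment> \<open>By the closure lemmas every function to which \<open>Z\<close> is applied lies
    in \<open>Conv_sc\<close>, where \<open>Z\<close> takes the value \<open>c\<close>; for maximum
    and minimum this is a premise of the valuation property.\<close>
  then show "epi_continuous_on Conv_sc Z \<and> epi_translation_invariant_on Conv_sc Z \<and>
          valuation_on Conv_sc Z \<and> epi_homogeneous_on 0 Conv_sc Z"
    by (simp add: epi_continuous_on_def epi_translation_invariant_on_def valuation_on_def
        epi_homogeneous_on_def Conv_sc_translate Conv_sc_add_const Conv_sc_epi_mult)
qed

end
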